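(* There exist a group $G$ and a finite generating set $\Sigma$ of $G$ such that: (i) $G$ does not have the falsification by fellow traveller property (FFTP) with respect to $\Sigma$; (ii) there is a total order on $\Sigma\cup\Sigma^{-1}$ for which $G$ has the shortlex falsification by fellow traveller property (SL-FFTP) with respect to $\Sigma$, and there is a total order on $\Sigma\cup\Sigma^{-1}$ for which $G$ does not have SL-FFTP with respect to $\Sigma$; (iii) for every total order on $\Sigma\cup\Sigma^{-1}$, the language of shortlex representatives $\mathrm{SL}_G$ is a regular language.
   Context: $\Sigma\cup\Sigma^{-1}$ is regarded as a finite subset of $G$, and $(\Sigma\cup\Sigma^{-1})^*$ is the set of finite words over it; $|w|$ is the length of a word $w$, and $w=_Gv$ means that $w$ and $v$ represent the same element of $G$. Shortlex order. For words $w_1,w_2$ over a totally ordered alphabet $(S,<)$: $w_1<_{\mathrm{lex}}w_2$ iff $w_1$ is a strict prefix of $w_2$ or, in the first position where they differ, the letter of $w_1$ is smaller than that of $w_2$; $w_1<_{\mathrm{SL}}w_2$ iff $|w_1|<|w_2|$, or $|w_1|=|w_2|$ and $w_1<_{\mathrm{lex}}w_2$. The order $<_{\mathrm{SL}}$ is a well-ordering. For $g\in G$, $\mathrm{SL}(g)$ is the $<_{\mathrm{SL}}$-minimal word in $(\Sigma\cup\Sigma^{-1})^*$ representing $g$, and $\mathrm{SL}_G=\{\mathrm{SL}(g):g\in G\}$ (depending on the chosen total order on $\Sigma\cup\Sigma^{-1}$). Fellow travelling. A word $w=s_1\cdots s_n$ determines the path in the Cayley graph of $G$ with respect to $\Sigma$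 with vertices $v_0=1_G$, $v_i=s_1\cdots s_i$. For $K\ge 0$, two paths with vertex sequences $v_0,\dots,v_n$ and $u_0,\dots,u_m$ asynchronously $K$-fellow travel if there are non-decreasing maps $f:\{0,\dots,n\}\to\{0,\dots,m\}$ and $g:\{0,\dots,m\}\to\{0,\dots,n\}$ such that $d(v_i,u_{f(i)})\le K$ for all $i$ and $d(u_j,v_{g(j)})\le K$ for all $j$, where $d$ is the graph distance. Two words asynchronously $K$-fellow travel if their paths starting at $1_G$ do. FFTP. $G$ has FFTP with respect to $\Sigma$ if there is a constant $K$ such that for every non-geodesic path $p$ in the Cayley graph of $G$ with respect to $\Sigma$ there is a path $q$ with the same endpoints as $p$, shorter than $p$, that asynchronously $K$-fellow travels with $p$. SL-FFTP. For a total order $<$ on $\Sigma\cup\Sigma^{-1}$, $G$ has SL-FFTP with respect to $\Sigma$ (and $<$) if there is a constant $K\ge0$ such that for every word $w\in(\Sigma\cup\Sigma^{-1})^*$ with $w\notin\mathrm{SL}_G$ there is a word $v\in(\Sigma\cup\Sigma^{-1})^*$ that asynchronously $K$-fellow travels with $w$ and satisfies $w=_Gv$ and $v<_{\mathrm{SL}}w$. A language is regular if it is the language accepted by a finite state automaton. *)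

theory Defs
  imports "HOL-Algebra.Generated_Groups"
begin

section \<open>Words over a symmetrised generating set\<close>

text \<open>The alphabet is a set of group elements, so an involution in \<open>X\<close> contributes one letter
  and not two. Words over it are the elements of \<open>lists (symgens G X)\<close>.\<close>

definition symgens :: "('a, 'b) monoid_scheme \<Rightarrow> 'a set \<Rightarrow> 'a set" where
  "symgens G X = X \<union> m_inv G ` X"

definition word_val :: "('a, 'b) monoid_scheme \<Rightarrow> 'a list \<Rightarrow> 'a" where
  "word_val G w = foldr (mult G) w \<one>\<^bsub>G\<^esub>"

definition finite_generating_set :: "('a, 'b) monoid_scheme \<Rightarrow> 'a set \<Rightarrow> bool" where
  "finite_generating_set G X \<longleftrightarrow> finite X \<and> X \<subseteq> carrier G \<and> generate G X = carrier G"


section \<open>Cayley graphs and fellow travelling\<close>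

text \<open>A path is given by its nonempty list of vertices. This loses no information: the letter
  labelling an edge from \<open>x\<close> to \<open>y\<close> is determined by \<open>x\<close> and \<open>y\<close>.
  The length of the path \<open>p\<close> is \<open>length p - 1\<close>.\<close>

definition cayley_path :: "('a, 'b) monoid_scheme \<Rightarrow> 'a set \<Rightarrow> 'a list \<Rightarrow> bool" where
  "cayley_path G X p \<longleftrightarrow> p \<noteq> [] \<and> set p \<subseteq> carrier G \<and>
     (\<forall>i. Suc i < length p \<longrightarrow> (\<exists>s\<in>symgens G X. p ! Suc i = p ! i \<otimes>\<^bsub>G\<^esub> s))"

definition cayley_dist :: "('a, 'b) monoid_scheme \<Rightarrow> 'a set \<Rightarrow> 'a \<Rightarrow> 'a \<Rightarrow> nat" where
  "cayley_dist G X x y =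
     (LEAST n. \<exists>p. cayley_path G X p \<and> hd p = x \<and> last p = y \<and> length p = Suc n)"

definition geodesic :: "('a, 'b) monoid_scheme \<Rightarrow> 'a set \<Rightarrow> 'a list \<Rightarrow> bool" where
  "geodesic G X p \<longleftrightarrow> cayley_path G X p \<and> length p - 1 = cayley_dist G X (hd p) (last p)"

definition word_path :: "('a, 'b) monoid_scheme \<Rightarrow> 'a list \<Rightarrow> 'a list" where
  "word_path G w = map (\<lambda>i. word_val G (take i w)) [0..<Suc (length w)]"

text \<open>Distances are natural numbers, so nothing is lost by taking the constant \<open>K\<close> in \<open>nat\<close>.\<close>

definition async_fellow_travel ::
    "('a, 'b) monoid_scheme \<Rightarrow> 'a set \<Rightarrow> nat \<Rightarrow> 'a list \<Rightarrow> 'a list \<Rightarrow> bool" where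
  "async_fellow_travel G X K p q \<longleftrightarrow>
     (\<exists>f g. mono_on {..<length p} f \<and> f ` {..<length p} \<subseteq> {..<length q} \<and>
            mono_on {..<length q} g \<and> g ` {..<length q} \<subseteq> {..<length p} \<and>
            (\<forall>i<length p. cayley_dist G X (p ! i) (q ! f i) \<le> K) \<and>
            (\<forall>j<length q. cayley_dist G X (q ! j) (p ! g j) \<le> K))"

definition FFTP :: "('a, 'b) monoid_scheme \<Rightarrow> 'a set \<Rightarrow> bool" where
  "FFTP G X \<longleftrightarrow>
     (\<exists>K. \<forall>p. cayley_path G X p \<and> \<not> geodesic G X p \<longrightarrow>
        (\<exists>q. cayley_path G X q \<and> hd q = hd p \<and> last q = last p \<and> length q < length p \<and>
             async_fellow_travel G X K p q))"


section \<open>Shortlex representatives\<close>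

text \<open>Total orders are given by their strict part.\<close>

definition strict_total_order :: "'a set \<Rightarrow> ('a \<times> 'a) set \<Rightarrow> bool" where
  "strict_total_order S r \<longleftrightarrow> r \<subseteq> S \<times> S \<and> strict_linear_order_on S r"

definition shortlex :: "('a \<times> 'a) set \<Rightarrow> ('a list \<times> 'a list) set" where
  "shortlex r = {(u, v). length u < length v \<or> length u = length v \<and> (u, v) \<in> lexord r}"

lemma shortlex_eq_lenlex: "shortlex r = lenlex r"
  by (auto simp: shortlex_def lenlex_conv lexord_lex)

definition SL :: "('a, 'b) monoid_scheme \<Rightarrow> 'a set \<Rightarrow> ('a \<times> 'a) set \<Rightarrow> 'a \<Rightarrow> 'a list" where
  "SL G X r g =
     (THE w. w \<in> lists (symgens G X) \<and> word_val G w = g \<and>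
        (\<forall>v\<in>lists (symgens G X). word_val G v = g \<and> v \<noteq> w \<longrightarrow> (w, v) \<in> shortlex r))"

lemma generate_word:
  assumes G: "group G" and X: "finite_generating_set G X" and g: "g \<in> carrier G"
  shows "\<exists>w\<in>lists (symgens G X). word_val G w = g"
proof -
  interpret group G by (rule G)
  have X': "X \<subseteq> carrier G" using X by (simp add: finite_generating_set_def)
  have S: "symgens G X \<subseteq> carrier G" using X' by (auto simp: symgens_def)
  have cl: "set w \<subseteq> carrier G \<Longrightarrow> word_val G w \<in> carrier G" for w
    by (induction w) (auto simp: word_val_def)
  have app: "set u \<subseteq> carrier G \<Longrightarrow> set v \<subseteq> carrier G \<Longrightarrow> word_val G (u @ v) = word_val G u \<otimes>\<^bsub>G\<^esub> word_val G v" for u v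
  proof (induction u)
    case Nil then show ?case using cl[of v] by (simp add: word_val_def)
  next
    case (Cons a u) then show ?case using cl[of u] cl[of v] by (simp add: word_val_def m_assoc)
  qed
  have "g \<in> generate G X" using X g by (simp add: finite_generating_set_def)
  then show ?thesis
  proof induction
    case one then show ?case by (rule bexI[of _ "[]"]) (simp_all add: word_val_def)
  next
    case (incl h) then show ?case using X' by (intro bexI[of _ "[h]"]) (auto simp: word_val_def symgens_def)
  next
    case (inv h) then show ?case using X' by (intro bexI[of _ "[inv\<^bsub>G\<^esub> h]"]) (auto simp: word_val_def symgens_def)
  next
    case (eng h1 h2)
    then obtain u v where "u \<in> lists (symgens G X)" "v \<in> lists (symgens G X)" "word_val G u = h1" "word_val G v = h2" by blast
    moreover have "set u \<subseteq> carrier G" "set v \<subseteq> carrier G" using calculation S by auto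
    ultimately show ?case using app by (intro bexI[of _ "u @ v"]) auto
  qed
qed

text \<open>The word described in the definition of \<open>SL\<close> exists and is unique.\<close>

lemma SL_unique_existence:
  assumes G: "group G" and X: "finite_generating_set G X"
    and r: "strict_total_order (symgens G X) r" and g: "g \<in> carrier G"
  shows "\<exists>!w. w \<in> lists (symgens G X) \<and> word_val G w = g \<and>
        (\<forall>v\<in>lists (symgens G X). word_val G v = g \<and> v \<noteq> w \<longrightarrow> (w, v) \<in> shortlex r)"
proof -
  let ?S = "symgens G X"
  have fin: "finite ?S" using X by (simp add: finite_generating_set_def symgens_def)
  have r': "r \<subseteq> ?S \<times> ?S" "trans r" "irrefl r" "total_on ?S r"
    using r by (auto simp: strict_total_order_def strict_linear_order_on_def)
  have "wf r" using r' fin by (metis acyclic_irrefl finite_acyclic_wf finite_subset finite_cartesian_product trancl_id)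
  then have wf: "wf (shortlex r)" unfolding shortlex_eq_lenlex by blast
  have tot: "u \<in> lists ?S \<Longrightarrow> v \<in> lists ?S \<Longrightarrow> length u = length v \<Longrightarrow> u \<noteq> v \<Longrightarrow> (u,v) \<in> lexord r \<or> (v,u) \<in> lexord r" for u v
  proof (induction u arbitrary: v)
    case Nil then show ?case by simp
  next
    case (Cons a u) then obtain b v' where v: "v = b # v'" by (cases v) auto
    show ?case using Cons v r'(4) by (auto simp: total_on_def)
  qed
  let ?Q = "{w \<in> lists ?S. word_val G w = g}"
  have "?Q \<noteq> {}" using generate_word[OF G X g] by auto
  then obtain w where w: "w \<in> ?Q" "\<And>v. (v,w) \<in> shortlex r \<Longrightarrow> v \<notin> ?Q"
    using wfE_min'[OF wf, of ?Q] by blast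
  have min: "(w,v) \<in> shortlex r" if "v \<in> ?Q" "v \<noteq> w" for v
    using w(1) w(2)[of v] that tot[of w v] by (auto simp: shortlex_def not_less_iff_gr_or_eq)
  have "\<not> ((u,v) \<in> shortlex r \<and> (v,u) \<in> shortlex r)" for u v using wf by (meson wf_asym)
  then show ?thesis using w(1) min by blast
qed

definition SL_language :: "('a, 'b) monoid_scheme \<Rightarrow> 'a set \<Rightarrow> ('a \<times> 'a) set \<Rightarrow> 'a list set" where
  "SL_language G X r = SL G X r ` carrier G"

definition SL_FFTP :: "('a, 'b) monoid_scheme \<Rightarrow> 'a set \<Rightarrow> ('a \<times> 'a) set \<Rightarrow> bool" where
  "SL_FFTP G X r \<longleftrightarrow>
     (\<exists>K. \<forall>w\<in>lists (symgens G X). w \<notin> SL_language G X r \<longrightarrow>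
        (\<exists>v\<in>lists (symgens G X).
           async_fellow_travel G X K (word_path G w) (word_path G v) \<and>
           word_val G v = word_val G w \<and> (v, w) \<in> shortlex r))"


section \<open>Regular languages\<close>

record ('q, 'a) automaton =
  states :: "'q set"
  initial :: 'q
  accepting :: "'q set"
  transition :: "'q \<Rightarrow> 'a \<Rightarrow> 'q"

definition finite_automaton :: "'a set \<Rightarrow> ('q, 'a) automaton \<Rightarrow> bool" where
  "finite_automaton S M \<longleftrightarrow>
     finite (states M) \<and> initial M \<in> states M \<and> accepting M \<subseteq> states M \<and>
     (\<forall>q\<in>states M. \<forall>a\<in>S. transition M q a \<in> states M)"

definition accepted_language :: "'a set \<Rightarrow> ('q, 'a) automaton \<Rightarrow> 'a list set" where
  "accepted_language S M = {w \<in> lists S. foldl (transition M) (initial M) w \<in> accepting M}"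

text \<open>Any finite state set can be renamed to a set of natural numbers.\<close>

definition regular_language :: "'a set \<Rightarrow> 'a list set \<Rightarrow> bool" where
  "regular_language S L \<longleftrightarrow>
     (\<exists>M :: (nat, 'a) automaton. finite_automaton S M \<and> L = accepted_language S M)"

end

theory Submission
  imports Defs "HOL-Library.Countable"
begin

text \<open>The group is the wreath product of \<open>\<int>\<close> by a group of order two, generated by \<open>a\<close>, which moves
  the first coordinate, and the exchange \<open>t\<close>. With \<open>A\<close> the inverse of \<open>a\<close> (so
  \<open>a, A, t\<close> are \<open>pa\<close>, \<open>na\<close>, \<open>ta\<close> below), the only geodesic for
  \<open>(-n, n, True)\<close> is \<open>A\<^sup>n t a\<^sup>n\<close>, and the longer word \<open>t a\<^sup>n t A\<^sup>n t\<close> with the same value runs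
  around the opposite corner of the square, so FFTP fails. If \<open>t\<close> is the largest letter, every
  factor \<open>t u t s\<close> with \<open>u\<close> and \<open>s\<close> free of \<open>t\<close> can be replaced by the lexicographically smaller
  \<open>s t u t\<close>, which stays close to it, and together with free cancellation these moves reach the
  shortlex representative. If \<open>a < t < A\<close>, no such move improves \<open>t a\<^sup>n t A\<^sup>n t\<close>. For every order the
  shortlex representatives are \<open>a\<^sup>i\<close>, \<open>a\<^sup>i t a\<^sup>j\<close> and one of \<open>a\<^sup>i t a\<^sup>j t\<close> and \<open>t a\<^sup>j t a\<^sup>i\<close>, the choice
  depending only on the sign of \<open>i\<close> and the order, so an automaton can recognise them.\<close>

section \<open>Word paths\<close>

lemma length_word_path [simp]: "length (word_path G w) = Suc (length w)"
  by (simp add: word_path_def)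

lemma word_path_nth: "i \<le> length w \<Longrightarrow> word_path G w ! i = word_val G (take i w)"
  unfolding word_path_def by (subst nth_map) (simp_all del: upt_Suc)

section \<open>The wreath product of \<open>\<int>\<close> by a group of order two\<close>

text \<open>The triple \<open>(x, y, e)\<close> stands for the translation \<open>(x, y)\<close> of \<open>\<int> \<times> \<int>\<close> followed by the
  exchange of the coordinates if \<open>e\<close> holds.\<close>

type_synonym elt = "int \<times> int \<times> bool"

fun mul :: "elt \<Rightarrow> elt \<Rightarrow> elt" where
  "mul (x, y, e) (x', y', e') = (if e then (x + y', y + x', \<not> e') else (x + x', y + y', e'))"

fun ivt :: "elt \<Rightarrow> elt" where
  "ivt (x, y, e) = (if e then (- y, - x, e) else (- x, - y, e))"

lemma mul_assoc: "mul (mul g h) k = mul g (mul h k)"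
  by (cases g; cases h; cases k) auto

lemma mul_one [simp]: "mul (0, 0, False) g = g" "mul g (0, 0, False) = g"
  by (cases g; auto)+

lemma mul_ivt [simp]: "mul (ivt g) g = (0, 0, False)" "mul g (ivt g) = (0, 0, False)"
  by (cases g; auto)+

lemma mul_ivt_cancel [simp]: "mul g (mul (ivt g) h) = h" "mul (ivt g) (mul g h) = h"
  by (simp_all flip: mul_assoc)

text \<open>The triples are coded by \<open>to_nat\<close> because the theorem asks for a
  \<open>nat monoid\<close>; \<open>from_nat\<close> undoes the coding.\<close>

definition wr :: "nat monoid" where
  "wr = \<lparr>carrier = range (to_nat :: elt \<Rightarrow> nat),
     mult = (\<lambda>m n. to_nat (mul (from_nat m) (from_nat n))),
     one = to_nat (0 :: int, 0 :: int, False)\<rparr>"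

lemma wr_simps [simp]:
  "carrier wr = range (to_nat :: elt \<Rightarrow> nat)"
  "m \<otimes>\<^bsub>wr\<^esub> n = to_nat (mul (from_nat m) (from_nat n))"
  "\<one>\<^bsub>wr\<^esub> = to_nat (0 :: int, 0 :: int, False)"
  by (simp_all add: wr_def)

lemma group_wr: "group wr"
proof (rule groupI)
  fix m assume "m \<in> carrier wr"
  then obtain g :: elt where "m = to_nat g" by auto
  then show "\<exists>n\<in>carrier wr. n \<otimes>\<^bsub>wr\<^esub> m = \<one>\<^bsub>wr\<^esub>"
    by (intro bexI[of _ "to_nat (ivt g)"]) simp_all
qed (auto simp: mul_assoc)

lemma inv_wr: "inv\<^bsub>wr\<^esub> (to_nat g) = to_nat (ivt g)"
  by (rule group.inv_equality[OF group_wr]) simp_all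

definition pa :: nat where "pa = to_nat (1 :: int, 0 :: int, False)"
definition na :: nat where "na = to_nat (- 1 :: int, 0 :: int, False)"
definition ta :: nat where "ta = to_nat (0 :: int, 0 :: int, True)"

lemma from_nat_letters [simp]:
  "(from_nat pa :: elt) = (1, 0, False)" "(from_nat na :: elt) = (- 1, 0, False)"
  "(from_nat ta :: elt) = (0, 0, True)"
  by (simp_all add: pa_def na_def ta_def)

lemma letters_distinct [simp]:
  "pa \<noteq> na" "na \<noteq> pa" "pa \<noteq> ta" "ta \<noteq> pa" "na \<noteq> ta" "ta \<noteq> na"
  by (simp_all add: pa_def na_def ta_def)

definition gens :: "nat set" where "gens = {pa, ta}"

lemma symgens_wr: "symgens wr gens = {pa, na, ta}"
  by (auto simp: symgens_def gens_def inv_wr pa_def na_def ta_def)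

fun val :: "nat list \<Rightarrow> elt" where
  "val [] = (0, 0, False)"
| "val (s # w) = mul (from_nat s) (val w)"

lemma word_val_wr: "word_val wr w = to_nat (val w)"
  by (induction w) (simp_all add: word_val_def)

lemma val_append [simp]: "val (u @ v) = mul (val u) (val v)"
  by (induction u) (simp_all add: mul_assoc)

text \<open>The word length, as \<open>length_nf\<close> and \<open>len_val_le\<close> show: the
  last summand counts the exchanges that are needed.\<close>

fun len :: "elt \<Rightarrow> int" where
  "len (x, y, e) = \<bar>x\<bar> + \<bar>y\<bar> + (if e then 1 else if y = 0 then 0 else 2)"

lemma len_nonneg: "len g \<ge> 0"
  by (cases g) auto

lemma len_mul_left: "s \<in> {pa, na, ta} \<Longrightarrow> len (mul (from_nat s) g) \<le> len g + 1"
  by (cases g) auto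

lemma len_mul_right: "s \<in> {pa, na, ta} \<Longrightarrow> len (mul g (from_nat s)) \<le> len g + 1"
  by (cases g) auto

lemma len_val_le: "set w \<subseteq> {pa, na, ta} \<Longrightarrow> len (val w) \<le> int (length w)"
proof (induction w)
  case (Cons s w)
  then show ?case using len_mul_left[of s "val w"] by simp
qed simp

section \<open>Shortlex normal forms\<close>

definition letter :: "int \<Rightarrow> nat" where "letter x = (if x > 0 then pa else na)"

definition pw :: "int \<Rightarrow> nat list" where "pw x = replicate (nat \<bar>x\<bar>) (letter x)"

lemma pw_0 [simp]: "pw 0 = []"
  by (simp add: pw_def)

lemma pw_Cons_pos: "x \<ge> 0 \<Longrightarrow> pw (1 + x) = pa # pw x"
  by (cases "x = 0") (simp_all add: pw_def letter_def nat_add_distrib)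

lemma pw_Cons_neg: 
  assumes "x \<le> 0" shows "pw (x - 1) = na # pw x"
proof -
  have "nat \<bar>x - 1\<bar> = Suc (nat \<bar>x\<bar>)" using assms by simp
  then show ?thesis using assms by (simp add: pw_def letter_def)
qed

lemma pw_eq_Nil [simp]: "pw x = [] \<longleftrightarrow> x = 0"
  by (simp add: pw_def)

lemma hd_pw: "x \<noteq> 0 \<Longrightarrow> hd (pw x) = letter x"
  by (simp add: pw_def)

lemma length_pw [simp]: "int (length (pw x)) = \<bar>x\<bar>"
  by (simp add: pw_def)

lemma set_pw: "set (pw x) \<subseteq> {pa, na}"
  by (auto simp: pw_def letter_def)

lemma val_replicate: "val (replicate n pa) = (int n, 0, False)" "val (replicate n na) = (- int n, 0, False)"
  by (induction n) auto

lemma val_pw [simp]: "val (pw x) = (x, 0, False)"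
  by (simp add: pw_def letter_def val_replicate)

text \<open>For \<open>e\<close> false and \<open>y \<noteq> 0\<close> the conjugate
  \<open>t a^y t\<close> commutes with \<open>a^x\<close>, so \<open>a^x\<close> may be split
  between its two sides; the lexicographically least choice puts all of it on one side, depending on
  how \<open>letter x\<close> compares with \<open>ta\<close>.\<close>

fun nf :: "(nat \<times> nat) set \<Rightarrow> elt \<Rightarrow> nat list" where
  "nf r (x, y, e) =
     (if e then pw x @ ta # pw y
      else if y = 0 then pw x
      else if x \<noteq> 0 \<and> (ta, letter x) \<in> r then ta # pw y @ ta # pw x
      else pw x @ ta # pw y @ [ta])"

lemma val_nf [simp]: "val (nf r g) = g"
  by (cases g) auto

lemma length_nf: "int (length (nf r g)) = len g"
  by (cases g) auto

lemma set_nf: "set (nf r g) \<subseteq> {pa, na, ta}"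
  using set_pw[of "fst g"] set_pw[of "fst (snd g)"] by (cases g) auto

text \<open>The induction step for \<open>nf_least\<close>. For a power letter \<open>s\<close> the
  length hypothesis fixes the sign of \<open>x\<close>, so \<open>s\<close> extends
  \<open>pw x\<close> unless a smaller \<open>ta\<close> leads the word; for \<open>ta\<close> the
  only alternative starts with a smaller power letter.\<close>

lemma nf_greedy:
  assumes r: "strict_total_order {pa, na, ta} r" and s: "s \<in> {pa, na, ta}"
    and len: "len (mul (from_nat s) g) = len g + 1"
  shows "nf r (mul (from_nat s) g) = s # nf r g \<or> (hd (nf r (mul (from_nat s) g)), s) \<in> r"
proof -
  obtain x y e where g: "g = (x, y, e)" by (cases g)
  have tot: "(letter z, ta) \<in> r" if "(ta, letter z) \<notin> r" for z
    using r that by (auto simp: strict_total_order_def strict_linear_order_on_def total_on_def letter_def)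
  consider "s = pa" | "s = na" | "s = ta" using s by auto
  then show ?thesis
  proof cases
    case 1
    then have "x \<ge> 0" using len g by (auto split: if_splits)
    then show ?thesis using 1 g by (auto simp: pw_Cons_pos letter_def)
  next
    case 2
    then have "x \<le> 0" using len g by (auto split: if_splits)
    then have "pw (- 1 + x) = na # pw x" using pw_Cons_neg[of x] by simp
    then show ?thesis using 2 g \<open>x \<le> 0\<close> by (auto simp: letter_def)
  next
    case 3
    show ?thesis
    proof (cases e)
      case True
      then show ?thesis using 3 g len tot[of y] by (auto simp: hd_append hd_pw split: if_splits)
    next
      case False
      then show ?thesis using 3 g len by (auto split: if_splits)
    qed
  qed
qed

text \<open>A non-geodesic word loses by its length. A geodesic word has a geodesic tail, so
  \<open>nf_greedy\<close> either decides at the first letter or passes to the tail.\<close>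

lemma nf_least:
  assumes r: "strict_total_order {pa, na, ta} r" and w: "set w \<subseteq> {pa, na, ta}" and ne: "w \<noteq> nf r (val w)"
  shows "(nf r (val w), w) \<in> shortlex r"
proof (cases "len (val w) = int (length w)")
  case False
  then show ?thesis using len_val_le[OF w] length_nf[of r "val w"] by (simp add: shortlex_def)
next
  case True
  have "(nf r (val w), w) \<in> lexord r"
    using True w ne
  proof (induction w)
    case Nil then show ?case by simp
  next
    case (Cons s w)
    have lw: "len (val w) = int (length w)" "len (mul (from_nat s) (val w)) = len (val w) + 1"
      using Cons.prems len_val_le[of w] len_mul_left[of s "val w"] by auto
    have "nf r (val (s # w)) \<noteq> []"
      using length_nf[of r "val (s # w)"] Cons.prems(1) by (metis length_greater_0_conv length_Cons of_nat_0_less_iff zero_less_Suc)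
    then obtain b z where bz: "nf r (val (s # w)) = b # z" by (cases "nf r (val (s # w))") auto
    show ?case
      using nf_greedy[OF r _ lw(2)] Cons.IH[OF lw(1)] Cons.prems bz by auto
  qed
  then show ?thesis using True length_nf[of r "val w"] by (simp add: shortlex_def)
qed

lemma finite_generating_set_wr: "finite_generating_set wr gens"
proof -
  interpret group wr by (rule group_wr)
  have gc: "gens \<subseteq> carrier wr" by (auto simp: gens_def pa_def ta_def)
  have "to_nat (val w) \<in> generate wr gens" if "set w \<subseteq> {pa, na, ta}" for w
    using that
  proof (induction w)
    case Nil
    show ?case using generate.one[of wr gens] by simp
  next
    case (Cons s w)
    have "na = inv\<^bsub>wr\<^esub> pa" by (simp add: pa_def na_def inv_wr)
    then have "na \<in> generate wr gens" using generate.inv[of pa gens wr] by (simp add: gens_def)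
    then have "s \<in> generate wr gens"
      using Cons.prems generate.incl[of _ gens wr] by (auto simp: gens_def)
    then show ?case using generate.eng[of s wr gens "to_nat (val w)"] Cons by simp
  qed
  \<comment> \<open>The empty relation serves as an order here because only some word with value
    \<open>g\<close> is wanted.\<close>
  then have "to_nat g \<in> generate wr gens" for g :: elt
    using set_nf[of "{}" g] by (metis val_nf)
  then show ?thesis
    using gc generate_in_carrier[OF gc] by (auto simp: finite_generating_set_def gens_def)
qed

lemma SL_language_wr:
  assumes r: "strict_total_order {pa, na, ta} r"
  shows "SL_language wr gens r = range (nf r)"
proof -
  have "SL wr gens r (to_nat g) = nf r g" for g
    unfolding SL_def
  proof (rule the1_equality)
    show "\<exists>!w. w \<in> lists (symgens wr gens) \<and> word_val wr w = to_nat g \<and>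
        (\<forall>v\<in>lists (symgens wr gens). word_val wr v = to_nat g \<and> v \<noteq> w \<longrightarrow> (w, v) \<in> shortlex r)"
      using SL_unique_existence[OF group_wr finite_generating_set_wr, of r "to_nat g"] r
      by (simp add: symgens_wr)
    show "nf r g \<in> lists (symgens wr gens) \<and> word_val wr (nf r g) = to_nat g \<and>
        (\<forall>v\<in>lists (symgens wr gens). word_val wr v = to_nat g \<and> v \<noteq> nf r g \<longrightarrow> (nf r g, v) \<in> shortlex r)"
      using set_nf[of r g] nf_least[OF r] by (auto simp: symgens_wr word_val_wr lists_eq_set)
  qed
  then show ?thesis by (auto simp: SL_language_def image_image)
qed

section \<open>Distances\<close>

definition dst :: "elt \<Rightarrow> elt \<Rightarrow> int" where "dst g h = len (mul (ivt g) h)"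

text \<open>Right multiplication by \<open>a\<close> moves the first coordinate when the flag is off
  and the second when it is on. With equal flags, a change in the other coordinate costs two
  exchanges.\<close>

lemma dst_simps:
  "dst (x, y, e) (x', y', e') = \<bar>x - x'\<bar> + \<bar>y - y'\<bar> +
     (if e \<noteq> e' then 1 else if (if e then x = x' else y = y') then 0 else 2)"
  by (auto simp: dst_def)

lemma cayley_path_word_path:
  assumes "set w \<subseteq> {pa, na, ta}"
  shows "cayley_path wr gens (word_path wr w)"
  unfolding cayley_path_def
proof (intro conjI allI impI)
  show "word_path wr w \<noteq> []" using length_word_path[of wr w] by force
  show "set (word_path wr w) \<subseteq> carrier wr" by (auto simp: word_path_def word_val_wr)
next
  fix i assume "Suc i < length (word_path wr w)"
  then have i: "i < length w" by simp
  then have "w ! i \<in> {pa, na, ta}" using assms nth_mem by blast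
  then show "\<exists>s\<in>symgens wr gens. word_path wr w ! Suc i = word_path wr w ! i \<otimes>\<^bsub>wr\<^esub> s"
    unfolding symgens_wr using i
    by (intro bexI[of _ "w ! i"]) (auto simp: word_path_nth word_val_wr take_Suc_conv_app_nth)
qed

lemma word_path_ends: 
  "hd (word_path wr w) = to_nat (0 :: int, 0 :: int, False)" "last (word_path wr w) = to_nat (val w)"
proof -
  have ne: "word_path wr w \<noteq> []" using length_word_path[of wr w] by force
  show "hd (word_path wr w) = to_nat (0 :: int, 0 :: int, False)"
    using ne word_path_nth[of 0 w wr] by (simp add: hd_conv_nth word_val_wr)
  show "last (word_path wr w) = to_nat (val w)"
    using ne word_path_nth[of "length w" w wr] by (simp add: last_conv_nth word_val_wr)
qed

lemma dst_path_le:
  assumes p: "cayley_path wr gens p" and ij: "i \<le> j" "j < length p"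
  shows "dst (from_nat (p ! i)) (from_nat (p ! j)) \<le> int (j - i)"
  using ij
proof (induction j rule: dec_induct)
  case base
  show ?case by (simp add: dst_def)
next
  case (step j)
  then obtain s where s: "s \<in> {pa, na, ta}" "p ! Suc j = p ! j \<otimes>\<^bsub>wr\<^esub> s"
    using p unfolding cayley_path_def symgens_wr by (meson Suc_lessD step.prems)
  then have "dst (from_nat (p ! i)) (from_nat (p ! Suc j)) \<le> dst (from_nat (p ! i)) (from_nat (p ! j)) + 1"
    using len_mul_right[OF s(1)] by (simp add: dst_def flip: mul_assoc)
  then show ?case using step by simp
qed

text \<open>Take the path of a geodesic word for \<open>mul (ivt g) h\<close> and translate it to
  start at \<open>g\<close>: left multiplication preserves edges.\<close>

lemma cayley_path_exists:
  "\<exists>p. cayley_path wr gens p \<and> hd p = to_nat g \<and> last p = to_nat h \<and> length p = Suc (nat (dst g h))"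
proof -
  define w where "w = nf {} (mul (ivt g) h)"
  define p where "p = map (\<lambda>m. to_nat (mul g (from_nat m))) (word_path wr w)"
  have w: "set w \<subseteq> {pa, na, ta}" unfolding w_def by (rule set_nf)
  have c: "cayley_path wr gens (word_path wr w)" by (rule cayley_path_word_path[OF w])
  have ne: "word_path wr w \<noteq> []" using c by (simp add: cayley_path_def)
  have "cayley_path wr gens p"
    unfolding cayley_path_def
  proof (intro conjI allI impI)
    fix i assume "Suc i < length p"
    then have i: "Suc i < length (word_path wr w)" by (simp add: p_def)
    then obtain s where s: "s \<in> symgens wr gens" "word_path wr w ! Suc i = word_path wr w ! i \<otimes>\<^bsub>wr\<^esub> s"
      using c unfolding cayley_path_def by blast
    show "\<exists>s\<in>symgens wr gens. p ! Suc i = p ! i \<otimes>\<^bsub>wr\<^esub> s"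
      using s i by (intro bexI[of _ s]) (simp_all add: p_def mul_assoc)
  qed (use ne in \<open>auto simp: p_def\<close>)
  moreover have "hd p = to_nat g" "last p = to_nat h"
    using ne by (simp_all add: p_def hd_map last_map word_path_ends w_def)
  moreover have "length p = Suc (nat (dst g h))"
    using length_nf[of "{}" "mul (ivt g) h"] by (simp add: p_def w_def dst_def)
  ultimately show ?thesis by blast
qed

lemma cayley_dist_wr: "int (cayley_dist wr gens (to_nat g) (to_nat h)) = dst g h"
proof -
  have "cayley_dist wr gens (to_nat g) (to_nat h) = nat (dst g h)"
    unfolding cayley_dist_def
  proof (rule Least_equality)
    fix n assume "\<exists>p. cayley_path wr gens p \<and> hd p = to_nat g \<and> last p = to_nat h \<and> length p = Suc n"
    then obtain p where p: "cayley_path wr gens p" "hd p = to_nat g" "last p = to_nat h" "length p = Suc n" by blast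
    then have "p ! 0 = to_nat g" "p ! n = to_nat h"
      by (metis hd_conv_nth list.size(3) nat.distinct(1)) (metis diff_Suc_1 last_conv_nth list.size(3) nat.distinct(1) p(3,4))
    then show "nat (dst g h) \<le> n"
      using dst_path_le[OF p(1), of 0 n] p(4) by simp
  qed (rule cayley_path_exists)
  then show ?thesis using len_nonneg by (simp add: dst_def)
qed


lemma dst_commute: "dst g h = dst h g"
  by (cases g; cases h) (auto simp: dst_simps)

lemma dst_mul_left [simp]: "dst (mul k g) (mul k h) = dst g h"
  by (cases g; cases h; cases k) (auto simp: dst_simps)

lemma dst_self [simp]: "dst g g = 0"
  by (simp add: dst_def)

section \<open>Fellow travelling words\<close>

lemma async_fellow_travelI:
  assumes "mono_on {..length w} f" "\<And>i. i \<le> length w \<Longrightarrow> f i \<le> length v"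
    and "mono_on {..length v} g" "\<And>j. j \<le> length v \<Longrightarrow> g j \<le> length w"
    and "\<And>i. i \<le> length w \<Longrightarrow> dst (val (take i w)) (val (take (f i) v)) \<le> int K"
    and "\<And>j. j \<le> length v \<Longrightarrow> dst (val (take j v)) (val (take (g j) w)) \<le> int K"
  shows "async_fellow_travel wr gens K (word_path wr w) (word_path wr v)"
proof -
  have "cayley_dist wr gens (word_path wr w ! i) (word_path wr v ! f i) \<le> K" if "i \<le> length w" for i
    using assms(5)[OF that] assms(2)[OF that] that
    by (simp add: word_path_nth word_val_wr flip: cayley_dist_wr)
  moreover have "cayley_dist wr gens (word_path wr v ! j) (word_path wr w ! g j) \<le> K" if "j \<le> length v" for j
    using assms(6)[OF that] assms(4)[OF that] that
    by (simp add: word_path_nth word_val_wr flip: cayley_dist_wr)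
  moreover have "f ` {..length w} \<subseteq> {..length v}" "g ` {..length v} \<subseteq> {..length w}"
    using assms(2,4) by auto
  ultimately show ?thesis
    unfolding async_fellow_travel_def length_word_path lessThan_Suc_atMost less_Suc_eq_le
    using assms(1,3) by blast
qed

lemma async_fellow_travel_cancel:
  assumes s: "s \<in> {pa, na, ta}" and o: "mul (from_nat s) (from_nat s') = (0, 0, False)"
  shows "async_fellow_travel wr gens 4 (word_path wr (x @ s # s' # y)) (word_path wr (x @ y))"
proof -
  \<comment> \<open>\<open>f\<close> collapses the excursion to the vertex after \<open>x\<close>,
    and \<open>g\<close> jumps over it. Matched vertices are at most 1 apart; 4 is the constant
    shared with \<open>async_fellow_travel_shift\<close>.\<close>
  define f where "f i = (if i \<le> length x then i else if i = Suc (length x) then length x else i - 2)" for i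
  define g where "g j = (if j \<le> length x then j else j + 2)" for j :: nat
  have split3: "i \<le> n \<or> i = Suc n \<or> (\<exists>k. i = n + Suc (Suc k))" for i n :: nat by presburger
  have far: "val (x @ s # s' # take k y) = val (x @ take k y)" for k
    by (simp add: o flip: mul_assoc)
  show ?thesis
  proof (rule async_fellow_travelI[of _ f _ g])
    fix i assume i: "i \<le> length (x @ s # s' # y)"
    consider "i \<le> length x" | "i = Suc (length x)" | k where "i = length x + Suc (Suc k)"
      using split3[of i "length x"] by blast
    then show "dst (val (take i (x @ s # s' # y))) (val (take (f i) (x @ y))) \<le> int 4"
    proof cases
      case 2
      have "dst (mul (val x) (from_nat s)) (mul (val x) (0, 0, False)) \<le> 4"
        unfolding dst_mul_left using s by (auto simp: dst_simps)
      then show ?thesis using 2 by (simp add: f_def)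
    next
      case (3 k)
      then show ?thesis using far[of k] by (simp add: f_def)
    qed (simp add: f_def)
  next
    fix j assume j: "j \<le> length (x @ y)"
    consider "j \<le> length x" | k where "j = length x + Suc k"
      using split3[of j "length x"] by (metis add_Suc_right add_0_right)
    then show "dst (val (take j (x @ y))) (val (take (g j) (x @ s # s' # y))) \<le> int 4"
    proof cases
      case (2 k)
      then show ?thesis using far[of "Suc k"] by (simp add: g_def eval_nat_numeral)
    qed (simp add: g_def)
  qed (auto simp: f_def g_def mono_on_def)
qed

lemma async_fellow_travel_shift:
  assumes s: "s \<in> {pa, na}" and W: "set W \<subseteq> {pa, na, ta}"
    and com: "mul (val W) (from_nat s) = mul (from_nat s) (val W)"
  shows "async_fellow_travel wr gens 4 (word_path wr (x @ W @ s # y)) (word_path wr (x @ s # W @ y))"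
proof -
  have near: "dst (val (take i (x @ W @ s # y))) (val (take i (x @ s # W @ y))) \<le> 4" for i
  proof -
    have "i \<le> n \<or> (\<exists>m<k. i = n + Suc m) \<or> (\<exists>m. i = n + Suc (k + m))" for n k :: nat by presburger
    from this[of "length x" "length W"]
    consider "i \<le> length x" | m where "i = length x + Suc m" "m < length W"
      | m where "i = length x + Suc (length W + m)"
      by blast
    then show ?thesis
    proof cases
      case (2 m)
      have "W ! m \<in> {pa, na, ta}" using 2 W nth_mem by blast
      \<comment> \<open>Up to the left factor \<open>val x\<close>, these are the vertices at the
        same time inside the block, with \<open>h\<close> the value of a prefix of \<open>W\<close>.
        The bound 4 is reached when the flag of \<open>h\<close> is on and \<open>W ! m\<close> is a
        power letter: two coordinates differ by one each, and two exchanges are needed.\<close>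
      then have "dst (mul h (from_nat (W ! m))) (mul (from_nat s) h) \<le> 4" for h
        using s by (cases h) (auto simp: dst_simps)
      then show ?thesis using 2 by (simp add: take_Suc_conv_app_nth)
    next
      case (3 m)
      have "mul (val W) (mul (from_nat s) h) = mul (from_nat s) (mul (val W) h)" for h
        using com by (simp flip: mul_assoc)
      then show ?thesis using 3 by (simp add: Suc_diff_le)
    qed simp
  qed
  then have "dst (val (take i (x @ s # W @ y))) (val (take i (x @ W @ s # y))) \<le> 4" for i
    by (simp only: dst_commute[of "val (take i (x @ s # W @ y))"])
  with near show ?thesis
    by (intro async_fellow_travelI[of _ "\<lambda>i. i" _ "\<lambda>i. i"]) (auto simp: mono_on_def)
qed

section \<open>An automaton for the shortlex normal forms\<close>

lemma regular_languageI:
  fixes \<delta> :: "'q \<Rightarrow> 'a \<Rightarrow> 'q"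
  assumes Q: "finite Q" "q0 \<in> Q" and \<delta>: "\<And>q a. q \<in> Q \<Longrightarrow> a \<in> S \<Longrightarrow> \<delta> q a \<in> Q"
  shows "regular_language S {w \<in> lists S. foldl \<delta> q0 w \<in> F}"
proof -
  obtain h :: "'q \<Rightarrow> nat" where h: "inj_on h Q"
    using finite_imp_inj_to_nat_seg[OF Q(1)] by blast
  define M where "M = \<lparr>states = h ` Q, initial = h q0, accepting = h ` (F \<inter> Q),
    transition = (\<lambda>n a. h (\<delta> (the_inv_into Q h n) a))\<rparr>"
  have "finite_automaton S M"
    using Q \<delta> by (auto simp: finite_automaton_def M_def the_inv_into_f_f[OF h])
  moreover have run: "foldl (transition M) (h q) w = h (foldl \<delta> q w) \<and> foldl \<delta> q w \<in> Q"
    if "w \<in> lists S" "q \<in> Q" for w q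
    using that
  proof (induction w arbitrary: q)
    case (Cons a w)
    then show ?case using \<delta>[of q a] by (simp add: M_def the_inv_into_f_f[OF h])
  qed simp
  have "foldl (transition M) (initial M) w \<in> accepting M \<longleftrightarrow> foldl \<delta> q0 w \<in> F" if "w \<in> lists S" for w
  proof -
    have "initial M = h q0" "accepting M = h ` (F \<inter> Q)" by (simp_all add: M_def)
    then show ?thesis using run[OF that Q(2)] inj_on_image_mem_iff[OF h, of _ "F \<inter> Q"] by simp
  qed
  then have "accepted_language S M = {w \<in> lists S. foldl \<delta> q0 w \<in> F}"
    unfolding accepted_language_def by blast
  ultimately show ?thesis unfolding regular_language_def by metis
qed

text \<open>A live state \<open>(n, f, l)\<close> records the number \<open>n\<close> of letters \<open>ta\<close> read so far, the letter \<open>f\<close>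
  occurring before the first of them, and the letter \<open>l\<close> occurring after the last of them.\<close>

type_synonym nf_state = "(nat \<times> nat option \<times> nat option) option"

text \<open>\<open>None\<close> is the dead state. The tests mirror \<open>nf\<close>: a second
  \<open>ta\<close> must follow a nonempty power, and letters after it need an empty first power and
  \<open>ta\<close> below them.\<close>

definition nf_step :: "(nat \<times> nat) set \<Rightarrow> nf_state \<Rightarrow> nat \<Rightarrow> nf_state" where
  "nf_step r q s = (case q of None \<Rightarrow> None | Some (n, f, l) \<Rightarrow>
     if s = ta then
       if n = 0 then Some (1, l, None)
       else if n = 1 \<and> l \<noteq> None \<and> (f \<noteq> None \<longrightarrow> (ta, the f) \<notin> r) then Some (2, f, None)
       else None
     else if l \<notin> {None, Some s} \<or> n = 2 \<and> \<not> (f = None \<and> (ta, s) \<in> r) then None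
     else Some (n, f, Some s))"

definition nf_run :: "(nat \<times> nat) set \<Rightarrow> nat list \<Rightarrow> nf_state" where
  "nf_run r = foldl (nf_step r) (Some (0, None, None))"

definition sgl :: "int \<Rightarrow> nat option" where "sgl x = (if x = 0 then None else Some (letter x))"

lemma letter_neq_ta [simp]: "letter x \<noteq> ta" "ta \<noteq> letter x"
  by (simp_all add: letter_def)

lemma sgl_0 [simp]: "sgl 0 = None"
  by (simp add: sgl_def)

lemma sgl_eq_None [simp]: "sgl x = None \<longleftrightarrow> x = 0"
  by (simp add: sgl_def)

lemma pw_snoc:
  assumes "s \<in> {pa, na}" "sgl x \<in> {None, Some s}"
  shows "\<exists>x'. pw x @ [s] = pw x' \<and> sgl x' = Some s \<and> x' \<noteq> 0 \<and> letter x' = s"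
proof -
  have rot: "pw x @ [s] = s # pw x"
    using assms(2) by (auto simp: pw_def sgl_def replicate_append_same split: if_splits)
  show ?thesis
  proof (cases "s = pa")
    case True
    then have "x \<ge> 0" using assms(2) by (auto simp: sgl_def letter_def split: if_splits)
    then show ?thesis using rot True
      by (intro exI[of _ "1 + x"]) (auto simp: pw_Cons_pos sgl_def letter_def)
  next
    case False
    then have "s = na" "x \<le> 0" using assms by (auto simp: sgl_def letter_def split: if_splits)
    then show ?thesis using rot
      by (intro exI[of _ "x - 1"]) (auto simp: pw_Cons_neg sgl_def letter_def)
  qed
qed

text \<open>The invariant for one inclusion of \<open>range_nf\<close>, by induction on the last
  letter: the state retains just enough about the powers to decide whether the next letter keeps the
  shape.\<close>

lemma nf_run_shape:
  assumes "set w \<subseteq> {pa, na, ta}" "nf_run r w = Some st"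
  obtains x where "w = pw x" "st = (0, None, sgl x)"
  | x y where "w = pw x @ ta # pw y" "st = (1, sgl x, sgl y)"
  | x y z where "w = pw x @ ta # pw y @ ta # pw z" "st = (2, sgl x, sgl z)" "y \<noteq> 0"
      "x \<noteq> 0 \<longrightarrow> (ta, letter x) \<notin> r" "z \<noteq> 0 \<longrightarrow> x = 0 \<and> (ta, letter z) \<in> r"
proof -
  have "(\<exists>x. w = pw x \<and> st = (0, None, sgl x)) \<or>
    (\<exists>x y. w = pw x @ ta # pw y \<and> st = (1, sgl x, sgl y)) \<or>
    (\<exists>x y z. w = pw x @ ta # pw y @ ta # pw z \<and> st = (2, sgl x, sgl z) \<and> y \<noteq> 0 \<and>
      (x \<noteq> 0 \<longrightarrow> (ta, letter x) \<notin> r) \<and> (z \<noteq> 0 \<longrightarrow> x = 0 \<and> (ta, letter z) \<in> r))"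
    (is "?shape w st")
    using assms
  proof (induction w arbitrary: st rule: rev_induct)
    case Nil
    then show ?case by (intro disjI1 exI[of _ 0]) (simp add: nf_run_def)
  next
    case (snoc s w)
    then obtain st' where st': "nf_run r w = Some st'" "nf_step r (Some st') s = Some st"
      by (cases "nf_run r w") (auto simp: nf_run_def nf_step_def)
    have "set w \<subseteq> {pa, na, ta}" "s \<in> {pa, na, ta}" using snoc.prems by auto
    note sh = snoc.IH[OF this(1) st'(1)]
    show ?case
    proof (cases "s = ta")
      case True
      from sh consider x where "w = pw x" "st' = (0, None, sgl x)"
        | x y where "w = pw x @ ta # pw y" "st' = (1, sgl x, sgl y)"
        | f l where "st' = (2, f, l)"
        by blast
      then show ?thesis
      proof cases
        case (1 x)
        then show ?thesis using True st'(2)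
          by (intro disjI2 disjI1 exI[of _ x] exI[of _ 0]) (auto simp: nf_step_def)
      next
        case (2 x y)
        then show ?thesis using True st'(2)
          by (intro disjI2 exI[of _ x] exI[of _ y] exI[of _ 0]) (auto simp: nf_step_def sgl_def split: if_splits)
      next
        case (3 f l)
        then show ?thesis using True st'(2) by (simp add: nf_step_def)
      qed
    next
      case False
      then have s: "s \<in> {pa, na}" using \<open>s \<in> {pa, na, ta}\<close> by auto
      from sh consider x where "w = pw x" "st' = (0, None, sgl x)"
        | x y where "w = pw x @ ta # pw y" "st' = (1, sgl x, sgl y)"
        | x y z where "w = pw x @ ta # pw y @ ta # pw z" "st' = (2, sgl x, sgl z)" "y \<noteq> 0"
        by blast
      then show ?thesis
      proof cases
        case (1 x)
        then have "sgl x \<in> {None, Some s}" "st = (0, None, Some s)"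
          using False st'(2) by (auto simp: nf_step_def split: if_splits)
        then show ?thesis using pw_snoc[OF s] 1 by metis
      next
        case (2 x y)
        then have "sgl y \<in> {None, Some s}" "st = (1, sgl x, Some s)"
          using False st'(2) by (auto simp: nf_step_def split: if_splits)
        then show ?thesis using pw_snoc[OF s, of y] 2 by (metis append_Cons append_assoc)
      next
        case (3 x y z)
        then have "sgl z \<in> {None, Some s}" "st = (2, sgl x, Some s)" "x = 0" "(ta, s) \<in> r"
          using False st'(2) by (auto simp: nf_step_def split: if_splits)
        then show ?thesis using pw_snoc[OF s, of z] 3 by (metis append_Cons append_assoc)
      qed
    qed
  qed
  then show thesis using that by blast
qed

lemma nf_run_pw:
  assumes "y = 0 \<or> n \<noteq> 2 \<or> f = None \<and> (ta, letter y) \<in> r"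
  shows "foldl (nf_step r) (Some (n, f, None)) (pw y) = Some (n, f, sgl y)"
proof -
  have *: "foldl (nf_step r) (Some (n, f, Some s)) (replicate k s) = Some (n, f, Some s)"
    if "s \<noteq> ta" "n \<noteq> 2 \<or> f = None \<and> (ta, s) \<in> r" for k s
    using that by (induction k) (auto simp: nf_step_def)
  show ?thesis
  proof (cases "nat \<bar>y\<bar>")
    case (Suc k)
    then show ?thesis using assms *[of "letter y" k] by (auto simp: pw_def sgl_def nf_step_def)
  qed (simp add: pw_def)
qed

lemma range_nf:
  "range (nf r) = {w \<in> lists {pa, na, ta}. nf_run r w \<in> - {None}}"
proof (intro equalityI subsetI)
  fix w assume "w \<in> range (nf r)"
  then obtain x y e where w: "w = nf r (x, y, e)" by auto
  have "nf_run r w \<noteq> None"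
    unfolding w nf_run_def by (auto simp: nf_run_pw) (auto simp: nf_run_pw nf_step_def sgl_def)
  then show "w \<in> {w \<in> lists {pa, na, ta}. nf_run r w \<in> - {None}}"
    using set_nf[of r "(x, y, e)"] w by (auto simp: lists_eq_set simp del: nf.simps)
next
  fix w assume w: "w \<in> {w \<in> lists {pa, na, ta}. nf_run r w \<in> - {None}}"
  then obtain st where "set w \<subseteq> {pa, na, ta}" "nf_run r w = Some st" by (auto simp: lists_eq_set)
  then have "\<exists>g. w = nf r g"
  proof (cases rule: nf_run_shape)
    case (1 x)
    then show ?thesis by (intro exI[of _ "(x, 0, False)"]) simp
  next
    case (2 x y)
    then show ?thesis by (intro exI[of _ "(x, y, True)"]) simp
  next
    case (3 x y z)
    \<comment> \<open>At most one of \<open>x\<close> and \<open>z\<close> is nonzero, so their sum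
      is the exponent on whichever side it stands.\<close>
    then show ?thesis by (intro exI[of _ "(x + z, y, False)"]) auto
  qed
  then show "w \<in> range (nf r)" by blast
qed

lemma regular_SL_language_wr:
  assumes "strict_total_order {pa, na, ta} r"
  shows "regular_language {pa, na, ta} (SL_language wr gens r)"
proof -
  define F where "F = {None, Some pa, Some na}"
  define Q where "Q = insert None (Some ` ({0, 1, 2 :: nat} \<times> F \<times> F))"
  have F: "finite F" "None \<in> F" "s \<in> {pa, na, ta} \<Longrightarrow> s \<noteq> ta \<Longrightarrow> Some s \<in> F" for s
    by (auto simp: F_def)
  have step: "nf_step r q s \<in> Q" if q: "q \<in> Q" and s: "s \<in> {pa, na, ta}" for q s
  proof (cases q)
    case None
    then show ?thesis by (simp add: nf_step_def Q_def)
  next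
    case (Some p)
    then obtain n f l where "q = Some (n, f, l)" "n \<in> {0, 1, 2}" "f \<in> F" "l \<in> F"
      using q unfolding Q_def by blast
    then show ?thesis using F(2) F(3)[OF s] by (simp add: nf_step_def Q_def image_iff)
  qed
  have "finite Q" "Some (0, None, None) \<in> Q" using F by (simp_all add: Q_def)
  then show ?thesis
    unfolding SL_language_wr[OF assms] range_nf nf_run_def by (rule regular_languageI) (rule step)
qed

section \<open>Orders with and without SL-FFTP\<close>

lemma SL_FFTP_wr:
  assumes r: "strict_total_order {pa, na, ta} r" and max: "(pa, ta) \<in> r" "(na, ta) \<in> r"
  shows "SL_FFTP wr gens r"
  unfolding SL_FFTP_def symgens_wr
proof (intro exI[of _ 4] ballI impI)
  fix w assume w: "w \<in> lists {pa, na, ta}" and nSL: "w \<notin> SL_language wr gens r"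
  have tr: "(ta, s) \<notin> r" for s
    using r max by (auto simp: strict_total_order_def strict_linear_order_on_def irrefl_def dest: transD)
  let ?goal = "\<exists>v\<in>lists {pa, na, ta}. async_fellow_travel wr gens 4 (word_path wr w) (word_path wr v) \<and>
           word_val wr v = word_val wr w \<and> (v, w) \<in> shortlex r"
  have "nf_run r w = None" using nSL w unfolding SL_language_wr[OF r] range_nf by blast
  \<comment> \<open>Cut \<open>w\<close> where the run dies: the prefix \<open>u\<close> has a shape
    from \<open>nf_run_shape\<close>, which \<open>s\<close> breaks.\<close>
  then have "\<exists>u s v st. w = u @ s # v \<and> nf_run r u = Some st \<and> nf_step r (Some st) s = None"
  proof (induction w rule: rev_induct)
    case (snoc s w)
    show ?case
    proof (cases "nf_run r w")
      case None
      then show ?thesis using snoc.IH by fastforce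
    next
      case (Some st)
      moreover have "nf_step r (Some st) s = None"
        using snoc.prems Some by (simp add: nf_run_def)
      ultimately show ?thesis by blast
    qed
  qed (simp add: nf_run_def)
  then obtain u s y st where us: "w = u @ s # y" "nf_run r u = Some st" "nf_step r (Some st) s = None"
    by blast
  have letters: "set u \<subseteq> {pa, na, ta}" "s \<in> {pa, na, ta}" "set y \<subseteq> {pa, na, ta}"
    using w us(1) by auto
  have cancel: ?goal if "u = x @ [c]" "mul (from_nat c) (from_nat s) = (0, 0, False)" for x c
    using that letters us(1) async_fellow_travel_cancel[of c s x y]
    by (intro bexI[of _ "x @ y"]) (auto simp: word_val_wr shortlex_def simp flip: mul_assoc)
  have pw_end: "\<exists>p. pw x = p @ [letter x]" if "x \<noteq> 0" for x
    by (metis append_butlast_last_id last_replicate pw_def pw_eq_Nil replicate_empty that)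
  \<comment> \<open>A nonempty power followed by the opposite letter ends in a cancelling
    pair.\<close>
  have opp: ?goal if "u = p @ pw x" "sgl x \<notin> {None, Some s}" "s \<noteq> ta" for p x
  proof -
    have "x \<noteq> 0" "letter x \<noteq> s" using that(2) by (auto simp: sgl_def split: if_splits)
    then show ?thesis using pw_end[of x] that letters cancel by (auto simp: letter_def split: if_splits)
  qed
  from letters(1) us(2) show ?goal
  proof (cases rule: nf_run_shape)
    case (1 x)
    then show ?thesis using us(3) opp[of "[]" x] by (auto simp: nf_step_def split: if_splits)
  next
    case (2 x z)
    show ?thesis
    proof (cases "s = ta")
      case True
      then have "z = 0" using 2 us(3) tr by (auto simp: nf_step_def split: if_splits)
      then show ?thesis using 2 True cancel[of "pw x" ta] by simp
    next
      case False
      then have "sgl z \<notin> {None, Some s}" using 2 us(3) by (auto simp: nf_step_def split: if_splits)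
      then show ?thesis using 2 False opp[of "pw x @ [ta]" z] by simp
    qed
  next
    case (3 x j z)
    \<comment> \<open>With \<open>ta\<close> largest, no power follows the second \<open>ta\<close>
      in a live prefix.\<close>
    then have z: "z = 0" using tr by blast
    show ?thesis
    proof (cases "s = ta")
      case True
      then show ?thesis using 3 z cancel[of "pw x @ ta # pw j" ta] by simp
    next
      case False
      then have s: "s \<in> {pa, na}" using letters by auto
      \<comment> \<open>This block commutes with \<open>s\<close>; moving \<open>s\<close> in front
        of it keeps the length and puts \<open>s\<close> in place of the larger \<open>ta\<close> at
        the first difference.\<close>
      let ?W = "ta # pw j @ [ta]"
      have W: "set ?W \<subseteq> {pa, na, ta}" using set_pw[of j] by auto
      have com: "mul (val ?W) (from_nat s) = mul (from_nat s) (val ?W)" using s by auto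
      have "w = pw x @ ?W @ s # y" using us(1) 3 z by simp
      moreover have "(pw x @ s # ?W @ y, pw x @ ?W @ s # y) \<in> shortlex r"
        using s max by (auto simp: shortlex_def intro: lexord_append_leftI)
      moreover have "val (pw x @ s # ?W @ y) = val (pw x @ ?W @ s # y)"
        using com by (metis val_append append_Cons append_Nil append_assoc mul_assoc val.simps)
      moreover have "pw x @ s # ?W @ y \<in> lists {pa, na, ta}"
        using letters s W set_pw[of x] by (auto simp: lists_eq_set)
      ultimately show ?thesis
        using async_fellow_travel_shift[OF s W com, of "pw x" y] unfolding word_val_wr by metis
    qed
  qed
qed

text \<open>A path from \<open>(c, 0, False)\<close> to \<open>(-n, n, True)\<close> through a point near \<open>(0, n, True)\<close> has to
  change the second coordinate before the first one, which takes three exchanges instead of one.\<close>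

lemma dst_detour:
  assumes "dst (0, n, True) z < n"
  shows "dst (c, 0, False) z + dst z (- n, n, True) \<ge> \<bar>c + n\<bar> + n + 3"
  using assms by (cases z) (auto simp: dst_simps split: if_splits)

definition zigzag :: "nat \<Rightarrow> nat list" where
  "zigzag n = ta # replicate n pa @ ta # replicate n na @ [ta]"

lemma length_zigzag [simp]: "length (zigzag n) = 2 * n + 3"
  by (simp add: zigzag_def)

lemma val_zigzag [simp]: "val (zigzag n) = (- int n, int n, True)"
  by (simp add: zigzag_def val_replicate)

lemma set_zigzag: "set (zigzag n) \<subseteq> {pa, na, ta}"
  by (auto simp: zigzag_def)

lemma zigzag_corner: "word_path wr (zigzag n) ! Suc n = to_nat (0 :: int, int n, True)"
proof -
  have "take (Suc n) (zigzag n) = ta # replicate n pa" by (simp add: zigzag_def)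
  then show ?thesis by (simp add: word_path_nth word_val_wr val_replicate)
qed

text \<open>At time \<open>n + 1\<close> the zigzag is at the corner \<open>(0, n, True)\<close>, so
  a fellow traveller comes within \<open>K < n\<close> of it. This provides the hypothesis of
  \<open>dst_detour\<close>.\<close>

lemma near_corner:
  assumes ft: "async_fellow_travel wr gens K (word_path wr (zigzag n)) q" and q: "cayley_path wr gens q"
    and K: "K < n"
  obtains j where "j < length q" "dst (0, int n, True) (from_nat (q ! j)) < int n"
proof -
  from ft obtain f where f: "f ` {..<length (word_path wr (zigzag n))} \<subseteq> {..<length q}"
    "\<forall>i<length (word_path wr (zigzag n)). cayley_dist wr gens (word_path wr (zigzag n) ! i) (q ! f i) \<le> K"
    unfolding async_fellow_travel_def by blast
  have "f (Suc n) < length q" using f(1) by (simp add: image_subset_iff)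
  moreover have "q ! f (Suc n) \<in> carrier wr" using q calculation by (auto simp: cayley_path_def)
  then obtain z :: elt where z: "q ! f (Suc n) = to_nat z" by auto
  moreover have "cayley_dist wr gens (to_nat (0 :: int, int n, True)) (to_nat z) \<le> K"
    using f(2)[rule_format, of "Suc n"] by (simp add: zigzag_corner z)
  then have "dst (0, int n, True) z < int n" using K by (simp flip: cayley_dist_wr)
  ultimately show thesis using that by simp
qed

lemma not_FFTP_wr: "\<not> FFTP wr gens"
proof
  assume "FFTP wr gens"
  then obtain K where K: "\<And>p. cayley_path wr gens p \<Longrightarrow> \<not> geodesic wr gens p \<Longrightarrow>
        \<exists>q. cayley_path wr gens q \<and> hd q = hd p \<and> last q = last p \<and> length q < length p \<and>
             async_fellow_travel wr gens K p q"
    unfolding FFTP_def by blast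
  define n where "n = Suc K"
  let ?p = "word_path wr (zigzag n)"
  have p: "cayley_path wr gens ?p" by (rule cayley_path_word_path[OF set_zigzag])
  have "int (cayley_dist wr gens (hd ?p) (last ?p)) = 2 * int n + 1"
    by (simp add: word_path_ends cayley_dist_wr dst_simps)
  then have "\<not> geodesic wr gens ?p" by (simp add: geodesic_def)
  then obtain q where q: "cayley_path wr gens q" "hd q = hd ?p" "last q = last ?p" "length q < length ?p"
    "async_fellow_travel wr gens K ?p q" using K p by blast
  obtain j where j: "j < length q" "dst (0, int n, True) (from_nat (q ! j)) < int n"
    using near_corner[OF q(5,1)] by (auto simp: n_def)
  have "q \<noteq> []" and jq: "j \<le> length q - 1" "length q - 1 < length q" using j by auto
  then have "q ! 0 = to_nat (0 :: int, 0 :: int, False)" "q ! (length q - 1) = to_nat (- int n, int n, True)"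
    using q(2,3) hd_conv_nth[of q] last_conv_nth[of q] by (simp_all add: word_path_ends)
  then show False
    \<comment> \<open>The pieces of \<open>q\<close> before and after \<open>j\<close> need at least
      \<open>2 * n + 3\<close> edges together, no fewer than the zigzag has.\<close>
    using dst_path_le[OF q(1) _ j(1), of 0] dst_path_le[OF q(1) jq] jq q(4)
      dst_detour[OF j(2), of 0] by simp
qed

text \<open>No letter is smaller than \<open>a\<close>, so the first difference comes after the
  block; the length hypothesis excludes a proper prefix.\<close>

lemma lexord_replicate_min:
  assumes "(v, replicate n a @ z) \<in> lexord r" "length v = n + length z" "\<And>s. (s, a) \<notin> r"
  shows "\<exists>v'. v = replicate n a @ v' \<and> (v', z) \<in> lexord r"
  using assms(1,2)
proof (induction n arbitrary: v)
  case (Suc n)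
  then obtain s v' where "v = s # v'" by (cases v) auto
  then show ?case using Suc assms(3) by auto
qed simp

text \<open>By the detour estimate a fellow traveller \<open>v\<close> of the zigzag is at least as
  long, so it would have to be lexicographically smaller. Reading \<open>v\<close> from the left
  forces agreement through the second \<open>ta\<close>, and the remaining \<open>A^n t\<close> is
  already a normal form.\<close>

lemma not_SL_FFTP_wr:
  assumes r: "strict_total_order {pa, na, ta} r" and mid: "(pa, ta) \<in> r" "(ta, na) \<in> r"
  shows "\<not> SL_FFTP wr gens r"
proof
  assume "SL_FFTP wr gens r"
  then obtain K where K: "\<And>w. w \<in> lists {pa, na, ta} \<Longrightarrow> w \<notin> SL_language wr gens r \<Longrightarrow>
        \<exists>v\<in>lists {pa, na, ta}. async_fellow_travel wr gens K (word_path wr w) (word_path wr v) \<and>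
           word_val wr v = word_val wr w \<and> (v, w) \<in> shortlex r"
    unfolding SL_FFTP_def symgens_wr by blast
  define n where "n = Suc K"
  have rS: "r \<subseteq> {pa, na, ta} \<times> {pa, na, ta}" and tr: "trans r" and ir: "irrefl r"
    using r by (auto simp: strict_total_order_def strict_linear_order_on_def)
  have asym_r: "asym r" using tr ir by (auto intro!: asymI simp: irrefl_def dest: transD)
  have irr: "(s, s) \<notin> r" for s using ir by (simp add: irrefl_def)
  have not_less: "(na, pa) \<notin> r" "(ta, pa) \<notin> r" "(na, ta) \<notin> r"
    using asymD[OF asym_r] mid transD[OF tr mid] by blast+
  have min_pa: "(s, pa) \<notin> r" for s
    using subsetD[OF rS, of "(s, pa)"] irr not_less by auto
  have below_ta: "s = pa" if "(s, ta) \<in> r" for s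
    using subsetD[OF rS that] that irr not_less by auto
  have "zigzag n \<noteq> nf r g" for g
  proof
    assume eq: "zigzag n = nf r g"
    then have "g = (- int n, int n, True)" by (metis val_nf val_zigzag)
    then show False using length_nf[of r g] unfolding eq[symmetric] by simp
  qed
  then have "zigzag n \<notin> SL_language wr gens r" using SL_language_wr[OF r] by auto
  then obtain v where v: "set v \<subseteq> {pa, na, ta}"
      "async_fellow_travel wr gens K (word_path wr (zigzag n)) (word_path wr v)"
      "word_val wr v = word_val wr (zigzag n)" "(v, zigzag n) \<in> shortlex r"
    using K[of "zigzag n"] set_zigzag[of n] by (auto simp: lists_eq_set)
  have val: "val v = (- int n, int n, True)" using v(3) by (simp add: word_val_wr)
  let ?q = "word_path wr v"
  have q: "cayley_path wr gens ?q" by (rule cayley_path_word_path[OF v(1)])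
  obtain j where j: "j < length ?q" "dst (0, int n, True) (from_nat (?q ! j)) < int n"
    using near_corner[OF v(2) q] by (auto simp: n_def)
  have q0: "?q ! 0 = to_nat (0 :: int, 0 :: int, False)" by (simp add: word_path_nth word_val_wr)
  have qe: "?q ! length v = to_nat (- int n, int n, True)" by (simp add: word_path_nth word_val_wr val)
  have "2 * n + 3 \<le> length v"
    using dst_path_le[OF q, of 0 j] dst_path_le[OF q, of j "length v"] j
      dst_detour[OF j(2), of 0] q0 qe by simp
  then have lv: "length v = 2 * n + 3" and lex: "(v, zigzag n) \<in> lexord r"
    using v(4) by (auto simp: shortlex_def)
  then obtain s v1 where s: "v = s # v1" by (cases v) auto
  \<comment> \<open>From \<open>(1, 0, False)\<close> the detour needs at least
    \<open>2 * n + 4\<close> edges, but only \<open>2 * n + 2\<close> letters remain.\<close>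
  have "s \<noteq> pa"
  proof
    assume "s = pa"
    have "j \<noteq> 0" using j(2) q0 by (auto simp: dst_simps intro: ccontr)
    moreover have "?q ! 1 = to_nat (1 :: int, 0 :: int, False)"
      using s \<open>s = pa\<close> by (simp add: word_path_nth word_val_wr)
    ultimately show False
      using dst_path_le[OF q, of 1 j] dst_path_le[OF q, of j "length v"] j
        dst_detour[OF j(2), of 1] qe lv by simp
  qed
  then have s': "s = ta" and lex1: "(v1, replicate n pa @ ta # replicate n na @ [ta]) \<in> lexord r"
    using lex below_ta s by (auto simp: zigzag_def)
  obtain v2 where v2: "v1 = replicate n pa @ v2" "(v2, ta # replicate n na @ [ta]) \<in> lexord r"
    using lexord_replicate_min[OF lex1 _ min_pa] lv s by auto
  then obtain c v3 where c: "v2 = c # v3" using lv s by (cases v2) auto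
  have "mul (0, int n, True) (val v2) = (- int n, int n, True)"
    using val s s' v2 by (simp add: val_replicate flip: mul_assoc)
  then have val2: "mul (from_nat c) (val v3) = (0, - int n, False)"
    using c by (cases "mul (from_nat c) (val v3)") auto
  have l3: "length v3 = n + 1" and set3: "set v3 \<subseteq> {pa, na, ta}" using lv s v2 c v(1) by auto
  \<comment> \<open>Otherwise \<open>v3\<close>, with \<open>n + 1\<close> letters, would represent
    an element of length \<open>n + 3\<close>.\<close>
  have "c \<noteq> pa"
  proof
    assume "c = pa"
    then have "val v3 = (- 1, - int n, False)" using val2 by (cases "val v3") auto
    then show False using len_val_le[OF set3] l3 by (auto simp: n_def)
  qed
  then have c': "c = ta" and lex3: "(v3, replicate n na @ [ta]) \<in> lexord r"
    using v2(2) c below_ta by auto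
  \<comment> \<open>Now \<open>v3\<close> would be smaller than the shortlex least word with its own
    value.\<close>
  have "val v3 = (- int n, 0, True)" using val2 c' by (cases "val v3") auto
  moreover have "nf r (- int n, 0, True) = replicate n na @ [ta]" by (simp add: pw_def letter_def)
  ultimately have nf3: "nf r (val v3) = replicate n na @ [ta]" by simp
  have asym: "(b, a) \<notin> lexord r" if "(a, b) \<in> lexord r" for a b
    using that lexord_asymmetric[of r] asym_r by (meson asymD)
  have "v3 \<noteq> replicate n na @ [ta]" using lex3 asym by blast
  then have "(replicate n na @ [ta], v3) \<in> shortlex r" using nf_least[OF r set3] nf3 by metis
  then show False using asym[OF lex3] l3 by (simp add: shortlex_def)
qed

theorem theorem2:
  shows "\<exists>(G :: nat monoid) X.
    group G \<and> finite_generating_set G X \<and>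
    \<not> FFTP G X \<and>
    (\<exists>r. strict_total_order (symgens G X) r \<and> SL_FFTP G X r) \<and>
    (\<exists>r. strict_total_order (symgens G X) r \<and> \<not> SL_FFTP G X r) \<and>
    (\<forall>r. strict_total_order (symgens G X) r \<longrightarrow>
         regular_language (symgens G X) (SL_language G X r))"
proof (intro exI[of _ wr] exI[of _ gens] conjI allI impI)
  let ?r = "{(pa, na), (pa, ta), (na, ta)}"
  have "strict_total_order {pa, na, ta} ?r"
    by (auto simp: strict_total_order_def strict_linear_order_on_def trans_def irrefl_def total_on_def)
  then show "\<exists>r. strict_total_order (symgens wr gens) r \<and> SL_FFTP wr gens r"
    using SL_FFTP_wr[of ?r] by (auto simp: symgens_wr)
  let ?r' = "{(pa, ta), (pa, na), (ta, na)}"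
  have "strict_total_order {pa, na, ta} ?r'"
    by (auto simp: strict_total_order_def strict_linear_order_on_def trans_def irrefl_def total_on_def)
  then show "\<exists>r. strict_total_order (symgens wr gens) r \<and> \<not> SL_FFTP wr gens r"
    using not_SL_FFTP_wr[of ?r'] by (auto simp: symgens_wr)
qed (simp_all add: group_wr finite_generating_set_wr not_FFTP_wr regular_SL_language_wr symgens_wr)

end
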